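(* Let $I\subset\mathbb{R}$ be an interval and let $\alpha:I\to\mathbb{E}^3$ be a smooth unit speed curve with curvature $\kappa>0$, torsion $\tau$ and Frenet frame $\{T,N,B\}$. Suppose that $\alpha$ is a slant helix with axis $d$, where $d$ is a fixed vector with $\|d\|=1$, and let $\theta$ be the constant angle between $N$ and $d$, so that $\langle N(s),d\rangle=\cos\theta$ for all $s\in I$. Then there is a sign $\varepsilon\in\{+1,-1\}$ such that, for all $s\in I$, $$d=\varepsilon\,\frac{\tau(s)}{\sqrt{\kappa(s)^2+\tau(s)^2}}\,\sin\theta\;T(s)+\cos\theta\;N(s)+\varepsilon\,\frac{\kappa(s)}{\sqrt{\kappa(s)^2+\tau(s)^2}}\,\sin\theta\;B(s).$$
   Context: $\mathbb{E}^3$ is Euclidean 3-space with inner product $\langle\cdot,\cdot\rangle$, norm $\|\cdot\|$ and cross product $\times$. For a unit speed curve $\alpha$ with curvature $\kappa=\|\alpha''\|>0$, the Frenet frame is $T=\alpha'$, $N=\alpha''/\|\alpha''\|$, $B=T\times N$, and the Frenet equations are $T'=\kappa N$, $N'=-\kappa T+\tau B$, $B'=-\tau N$, where $\tau=\langle\alpha'\times\alpha'',\alpha'''\rangle/\kappa^2$ is the torsion. A space curve is called a slant helix if its principal normal vectors $N$ make a constant angle with a fixed vector; this fixed vector is called the axis of the slant helix. *)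

theory Defs
  imports "HOL-Analysis.Analysis"
begin

text \<open>
  A curve on an interval I is a total function of which only the values on I matter: all
  derivatives are taken within I, hence are one-sided at endpoints belonging to I. On an interval
  with nonempty interior these derivatives are unique.
\<close>

definition nondegenerate_interval :: "real set \<Rightarrow> bool" where
  "nondegenerate_interval I \<longleftrightarrow> is_interval I \<and> interior I \<noteq> {}"

primrec nderiv_on :: "real set \<Rightarrow> nat \<Rightarrow> (real \<Rightarrow> 'a::real_normed_vector) \<Rightarrow> real \<Rightarrow> 'a" where
  "nderiv_on I 0 f = f"
| "nderiv_on I (Suc n) f = (\<lambda>s. vector_derivative (nderiv_on I n f) (at s within I))"

definition smooth_curve_on :: "real set \<Rightarrow> (real \<Rightarrow> 'a::real_normed_vector) \<Rightarrow> bool" where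
  "smooth_curve_on I f \<longleftrightarrow> (\<forall>n. nderiv_on I n f differentiable_on I)"

definition unit_speed_on :: "real set \<Rightarrow> (real \<Rightarrow> 'a::real_normed_vector) \<Rightarrow> bool" where
  "unit_speed_on I f \<longleftrightarrow> (\<forall>s\<in>I. norm (nderiv_on I 1 f s) = 1)"

definition curvature :: "real set \<Rightarrow> (real \<Rightarrow> real^3) \<Rightarrow> real \<Rightarrow> real" where
  "curvature I \<alpha> s = norm (nderiv_on I 2 \<alpha> s)"

definition torsion :: "real set \<Rightarrow> (real \<Rightarrow> real^3) \<Rightarrow> real \<Rightarrow> real" where
  "torsion I \<alpha> s =
     inner (cross3 (nderiv_on I 1 \<alpha> s) (nderiv_on I 2 \<alpha> s)) (nderiv_on I 3 \<alpha> s) / (curvature I \<alpha> s)\<^sup>2"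

definition tangent :: "real set \<Rightarrow> (real \<Rightarrow> real^3) \<Rightarrow> real \<Rightarrow> real^3" where
  "tangent I \<alpha> s = nderiv_on I 1 \<alpha> s"

definition principal_normal :: "real set \<Rightarrow> (real \<Rightarrow> real^3) \<Rightarrow> real \<Rightarrow> real^3" where
  "principal_normal I \<alpha> s = nderiv_on I 2 \<alpha> s /\<^sub>R norm (nderiv_on I 2 \<alpha> s)"

definition binormal :: "real set \<Rightarrow> (real \<Rightarrow> real^3) \<Rightarrow> real \<Rightarrow> real^3" where
  "binormal I \<alpha> s = cross3 (tangent I \<alpha> s) (principal_normal I \<alpha> s)"

text \<open>The unoriented angle, in the range from 0 to pi; meaningful for nonzero vectors only.\<close>

definition vec_angle :: "'a::real_inner \<Rightarrow> 'a \<Rightarrow> real" where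
  "vec_angle u v = arccos (inner u v / (norm u * norm v))"

definition slant_helix_with_axis :: "real set \<Rightarrow> (real \<Rightarrow> real^3) \<Rightarrow> real^3 \<Rightarrow> bool" where
  "slant_helix_with_axis I \<alpha> d \<longleftrightarrow>
     d \<noteq> 0 \<and> (\<exists>\<phi>. \<forall>s\<in>I. vec_angle (principal_normal I \<alpha> s) d = \<phi>)"

end

theory Submission
  imports Defs
begin

text \<open>
  Differentiating \<open>\<langle>\<alpha>'', d\<rangle> = cos \<theta> \<parallel>\<alpha>''\<parallel>\<close> gives \<open>\<kappa> \<langle>T, d\<rangle> = \<tau> \<langle>B, d\<rangle>\<close>. Together with
  \<open>\<langle>T, d\<rangle>\<^sup>2 + \<langle>B, d\<rangle>\<^sup>2 = sin\<^sup>2 \<theta>\<close> this determines \<open>\<langle>T, d\<rangle>\<close> and \<open>\<langle>B, d\<rangle>\<close> up to a common sign at each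
  point. If \<open>sin \<theta> \<noteq> 0\<close>, then \<open>\<langle>B, d\<rangle>\<close> is continuous without zeros on an interval, so the
  sign does not depend on the point.
\<close>

section \<open>Vector algebra in Euclidean 3-space\<close>

text \<open>With \<open>u = cross3 t n\<close>, the vector \<open>cross3 u (cross3 u v)\<close> is
  computed in two ways: as minus the projection of \<open>v\<close> to the plane of \<open>t\<close>
  and \<open>n\<close>, and by Lagrange's formula as \<open>inner u v *\<^sub>R u - v\<close>.
  Comparing the two gives the expansion.\<close>

lemma orthonormal_cross3_expansion:
  fixes t n v :: "real^3"
  assumes "norm t = 1" "norm n = 1" "inner t n = 0"
  shows "v = inner t v *\<^sub>R t + inner n v *\<^sub>R n + inner (cross3 t n) v *\<^sub>R cross3 t n"
proof -
  define u where "u = cross3 t n"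
  have tt: "inner t t = 1" and nn: "inner n n = 1" and nt: "inner n t = 0"
    using assms by (simp_all add: dot_square_norm inner_commute)
  have "(norm u)\<^sup>2 = 1"
    using assms norm_and_cross_eq_0 by (simp add: u_def norm_cross)
  then have uu: "inner u u = 1"
    by (simp add: dot_square_norm)
  have triple: "cross3 u w = inner t w *\<^sub>R n - inner n w *\<^sub>R t" for w
    using Lagrange [of w t n] cross_skew [of u w] by (simp add: u_def inner_commute)
  have "cross3 u (cross3 u v) = inner t v *\<^sub>R cross3 u n - inner n v *\<^sub>R cross3 u t"
    by (simp add: triple [of v] cross_mult_right Cross3.right_diff_distrib)
  also have "\<dots> = - inner t v *\<^sub>R t - inner n v *\<^sub>R n"
    by (simp add: triple tt nn nt assms(3))
  finally have "- inner t v *\<^sub>R t - inner n v *\<^sub>R n = inner u v *\<^sub>R u - v"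
    using Lagrange [of u u v] uu by simp
  then show ?thesis
    by (simp add: u_def algebra_simps)
qed

section \<open>Calculus within an interval\<close>

text \<open>A connected set other than a singleton has no isolated points. This makes derivatives
  within \<open>I\<close> unique, at endpoints too.\<close>

lemma nondegenerate_interval_trivial_limit:
  assumes "nondegenerate_interval I" "s \<in> I"
  shows "at s within I \<noteq> bot"
proof -
  have "I \<noteq> {s}"
    using assms(1) by (auto simp: nondegenerate_interval_def)
  then have "s islimpt I"
    using assms connected_imp_perfect is_interval_connected
    unfolding nondegenerate_interval_def by blast
  then show ?thesis
    by (simp add: trivial_limit_within)
qed

lemma smooth_curve_on_has_vector_derivative:
  assumes "smooth_curve_on I f" "s \<in> I"
  shows "(nderiv_on I n f has_vector_derivative nderiv_on I (Suc n) f s) (at s within I)"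
  using assms by (auto simp: smooth_curve_on_def differentiable_on_def vector_derivative_works)

lemma smooth_curve_on_continuous_on:
  "smooth_curve_on I f \<Longrightarrow> continuous_on I (nderiv_on I n f)"
  by (simp add: smooth_curve_on_def differentiable_imp_continuous_on)

text \<open>This is the tool for differentiating an identity valid on all of \<open>I\<close>: the
  given derivative and the derivative 0 of a constant must agree by uniqueness.\<close>

lemma has_vector_derivative_zero_if_constant_on:
  assumes "(f has_vector_derivative D) (at s within I)" "at s within I \<noteq> bot" "s \<in> I"
    and "\<And>t. t \<in> I \<Longrightarrow> f t = c"
  shows "D = 0"
proof -
  have "((\<lambda>_. c) has_vector_derivative D) (at s within I)"
    using assms by (intro has_vector_derivative_transform [OF _ _ assms(1)]) auto
  then show ?thesis
    using assms(2) vector_derivative_unique_within has_vector_derivative_const by blast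
qed

lemma connected_nonvanishing_sign:
  fixes f :: "real \<Rightarrow> real"
  assumes "connected I" "continuous_on I f" "\<And>s. s \<in> I \<Longrightarrow> f s \<noteq> 0"
  obtains e where "e \<in> {1, -1::real}" "\<And>s. s \<in> I \<Longrightarrow> f s = e * \<bar>f s\<bar>"
proof -
  have conn: "connected (f ` I)"
    using assms connected_continuous_image by blast
  have "0 \<notin> f ` I"
    using assms(3) by force
  \<comment> \<open>A connected set of reals with elements on both sides of 0 would contain
    0.\<close>
  then have "(\<forall>s\<in>I. f s > 0) \<or> (\<forall>s\<in>I. f s < 0)"
    using connectedD_interval [OF conn, of _ _ 0] assms(3)
    by (metis imageI less_eq_real_def linorder_not_less)
  then show thesis
    using that [of 1] that [of "-1"] by force
qed

section \<open>The unoriented angle\<close>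

lemma abs_normalized_inner_le_1:
  fixes u v :: "'a::real_inner"
  assumes "u \<noteq> 0" "v \<noteq> 0"
  shows "\<bar>inner u v / (norm u * norm v)\<bar> \<le> 1"
  using Cauchy_Schwarz_ineq2 [of u v] assms by (simp add: divide_simps)

lemma cos_vec_angle:
  fixes u v :: "'a::real_inner"
  assumes "u \<noteq> 0" "v \<noteq> 0"
  shows "cos (vec_angle u v) = inner u v / (norm u * norm v)"
  unfolding vec_angle_def by (rule cos_arccos_abs [OF abs_normalized_inner_le_1 [OF assms]])

text \<open>The values of \<open>arccos\<close> lie between 0 and \<open>pi\<close>. This later
  fixes the sign when a root of the squared sine is taken.\<close>

lemma sin_vec_angle_nonneg:
  fixes u v :: "'a::real_inner"
  assumes "u \<noteq> 0" "v \<noteq> 0"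
  shows "0 \<le> sin (vec_angle u v)"
  using abs_normalized_inner_le_1 [OF assms] unfolding vec_angle_def
  by (intro sin_ge_zero arccos_lbound arccos_ubound; linarith)

section \<open>The Frenet frame and the third derivative\<close>

context
  fixes I :: "real set" and \<alpha> :: "real \<Rightarrow> real^3"
  assumes I: "nondegenerate_interval I"
    and smooth: "smooth_curve_on I \<alpha>"
    and unit: "unit_speed_on I \<alpha>"
    and curv: "\<forall>s\<in>I. curvature I \<alpha> s > 0"
begin

lemma norm_tangent: "s \<in> I \<Longrightarrow> norm (tangent I \<alpha> s) = 1"
  using unit by (simp add: unit_speed_on_def tangent_def)

lemma second_derivative_eq: "nderiv_on I 2 \<alpha> s = curvature I \<alpha> s *\<^sub>R principal_normal I \<alpha> s"
  \<comment> \<open>If the second derivative vanishes, both sides are 0.\<close>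
  by (cases "nderiv_on I 2 \<alpha> s = 0") (simp_all add: curvature_def principal_normal_def)

lemma norm_principal_normal: "s \<in> I \<Longrightarrow> norm (principal_normal I \<alpha> s) = 1"
  using curv by (auto simp: principal_normal_def curvature_def)

lemma has_vector_derivative_nderiv_12:
  assumes "s \<in> I"
  shows "(nderiv_on I 1 \<alpha> has_vector_derivative nderiv_on I 2 \<alpha> s) (at s within I)"
    and "(nderiv_on I 2 \<alpha> has_vector_derivative nderiv_on I 3 \<alpha> s) (at s within I)"
  using smooth_curve_on_has_vector_derivative [OF smooth assms, of 1]
    smooth_curve_on_has_vector_derivative [OF smooth assms, of 2]
  by (simp_all only: Suc_1 eval_nat_numeral)

lemma inner_tangent_second_derivative:
  assumes "s \<in> I"
  shows "inner (nderiv_on I 1 \<alpha> s) (nderiv_on I 2 \<alpha> s) = 0"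
proof -
  have D: "((\<lambda>t. inner (nderiv_on I 1 \<alpha> t) (nderiv_on I 1 \<alpha> t)) has_vector_derivative
      inner (nderiv_on I 1 \<alpha> s) (nderiv_on I 2 \<alpha> s) +
      inner (nderiv_on I 2 \<alpha> s) (nderiv_on I 1 \<alpha> s)) (at s within I)"
    by (intro bounded_bilinear.has_vector_derivative [OF bounded_bilinear_inner]
        has_vector_derivative_nderiv_12 assms)
  have "inner (nderiv_on I 1 \<alpha> t) (nderiv_on I 1 \<alpha> t) = 1" if "t \<in> I" for t
    using unit that by (simp add: unit_speed_on_def dot_square_norm)
  from has_vector_derivative_zero_if_constant_on
    [OF D nondegenerate_interval_trivial_limit [OF I assms] assms this]
  show ?thesis
    by (simp add: inner_commute)
qed

lemma inner_tangent_principal_normal: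
  "s \<in> I \<Longrightarrow> inner (tangent I \<alpha> s) (principal_normal I \<alpha> s) = 0"
  using inner_tangent_second_derivative [of s] by (simp add: tangent_def principal_normal_def)

text \<open>Differentiate the orthogonality of the first two derivatives. The frame coordinates of
  the third derivative take the place of the Frenet equations, so that N itself is never
  differentiated.\<close>

lemma inner_tangent_third_derivative:
  assumes "s \<in> I"
  shows "inner (tangent I \<alpha> s) (nderiv_on I 3 \<alpha> s) = - (curvature I \<alpha> s)\<^sup>2"
proof -
  have D: "((\<lambda>t. inner (nderiv_on I 1 \<alpha> t) (nderiv_on I 2 \<alpha> t)) has_vector_derivative
      inner (nderiv_on I 1 \<alpha> s) (nderiv_on I 3 \<alpha> s) +
      inner (nderiv_on I 2 \<alpha> s) (nderiv_on I 2 \<alpha> s)) (at s within I)"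
    by (intro bounded_bilinear.has_vector_derivative [OF bounded_bilinear_inner]
        has_vector_derivative_nderiv_12 assms)
  from has_vector_derivative_zero_if_constant_on
    [OF D nondegenerate_interval_trivial_limit [OF I assms] assms inner_tangent_second_derivative]
  show ?thesis
    by (simp add: tangent_def curvature_def dot_square_norm)
qed

text \<open>The cross product in the definition of \<open>torsion\<close> is
  \<open>curvature I \<alpha> s *\<^sub>R binormal I \<alpha> s\<close>, so one factor of the
  squared curvature cancels.\<close>

lemma inner_binormal_third_derivative:
  assumes "s \<in> I"
  shows "inner (binormal I \<alpha> s) (nderiv_on I 3 \<alpha> s) = curvature I \<alpha> s * torsion I \<alpha> s"
proof -
  have "curvature I \<alpha> s > 0"
    using curv assms by simp
  then show ?thesis
    by (simp add: binormal_def torsion_def tangent_def second_derivative_eq cross_mult_right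
        power2_eq_square)
qed

lemma frame_expansion:
  assumes "s \<in> I"
  shows "v = inner (tangent I \<alpha> s) v *\<^sub>R tangent I \<alpha> s
    + inner (principal_normal I \<alpha> s) v *\<^sub>R principal_normal I \<alpha> s
    + inner (binormal I \<alpha> s) v *\<^sub>R binormal I \<alpha> s"
  unfolding binormal_def
  by (intro orthonormal_cross3_expansion norm_tangent norm_principal_normal
      inner_tangent_principal_normal assms)

text \<open>Parseval's identity, used for the third derivative against \<open>d\<close> and for
  \<open>d\<close> against itself.\<close>

lemma inner_frame_expansion:
  assumes "s \<in> I"
  shows "inner v w = inner (tangent I \<alpha> s) v * inner (tangent I \<alpha> s) w
    + inner (principal_normal I \<alpha> s) v * inner (principal_normal I \<alpha> s) w
    + inner (binormal I \<alpha> s) v * inner (binormal I \<alpha> s) w"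
  by (subst frame_expansion [OF assms, of v]) (simp add: inner_add_left)

section \<open>The axis in the Frenet frame\<close>

lemma curvature_inner_tangent_axis:
  assumes axis: "\<And>t. t \<in> I \<Longrightarrow> inner (principal_normal I \<alpha> t) d = c" and s: "s \<in> I"
  shows "curvature I \<alpha> s * inner (tangent I \<alpha> s) d = torsion I \<alpha> s * inner (binormal I \<alpha> s) d"
proof -
  let ?A2 = "nderiv_on I 2 \<alpha>" and ?A3 = "nderiv_on I 3 \<alpha>"
  have k: "curvature I \<alpha> s > 0"
    using curv s by simp
  have "(?A2 has_derivative (\<lambda>h. h *\<^sub>R ?A3 s)) (at s within I)"
    using has_vector_derivative_nderiv_12(2) [OF s] by (simp add: has_vector_derivative_def)
  \<comment> \<open>Away from 0 the norm is differentiable with gradient \<open>sgn\<close>; at the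
    second derivative this gradient is the principal normal.\<close>
  moreover have "?A2 s \<noteq> 0"
    using k by (auto simp: curvature_def)
  ultimately have "((\<lambda>t. inner (?A2 t) d - c * norm (?A2 t)) has_derivative
      (\<lambda>h. inner (h *\<^sub>R ?A3 s) d - c * inner (h *\<^sub>R ?A3 s) (sgn (?A2 s)))) (at s within I)"
    by (auto intro!: derivative_eq_intros
        has_derivative_compose [of ?A2 _ s I norm, OF _ has_derivative_norm])
  then have D: "((\<lambda>t. inner (?A2 t) d - c * norm (?A2 t)) has_vector_derivative
      inner (?A3 s) d - c * inner (?A3 s) (principal_normal I \<alpha> s)) (at s within I)"
    by (simp add: has_vector_derivative_def principal_normal_def sgn_div_norm algebra_simps)
  have "inner (?A2 t) d - c * norm (?A2 t) = 0" if "t \<in> I" for t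
    using axis [OF that] by (simp add: second_derivative_eq norm_principal_normal that curv less_imp_le)
  from has_vector_derivative_zero_if_constant_on
    [OF D nondegenerate_interval_trivial_limit [OF I s] s this]
  have "inner (?A3 s) d = inner (principal_normal I \<alpha> s) (?A3 s) * inner (principal_normal I \<alpha> s) d"
    by (simp add: axis [OF s] inner_commute [of "?A3 s" "principal_normal I \<alpha> s"])
  \<comment> \<open>In the frame expansion of \<open>inner (?A3 s) d\<close> the normal term cancels
    against the right-hand side above, so the tangent and binormal terms add up to 0.\<close>
  then have "curvature I \<alpha> s * (curvature I \<alpha> s * inner (tangent I \<alpha> s) d)
      = curvature I \<alpha> s * (torsion I \<alpha> s * inner (binormal I \<alpha> s) d)"
    using inner_frame_expansion [OF s, of "?A3 s" d]
    by (auto simp: inner_tangent_third_derivative inner_binormal_third_derivative s power2_eq_square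
        algebra_simps)
  then show ?thesis
    using k by simp
qed

lemma continuous_on_binormal: "continuous_on I (binormal I \<alpha>)"
  unfolding binormal_def tangent_def principal_normal_def
  using curv
  by (intro continuous_on_cross continuous_intros smooth_curve_on_continuous_on smooth)
    (auto simp: curvature_def)

end

theorem mainTheorem1:
  fixes I :: "real set" and \<alpha> :: "real \<Rightarrow> real^3" and d :: "real^3" and \<theta> :: real
  assumes "nondegenerate_interval I"
    and "smooth_curve_on I \<alpha>"
    and "unit_speed_on I \<alpha>"
    and "\<forall>s\<in>I. curvature I \<alpha> s > 0"
    and "norm d = 1"
    and "slant_helix_with_axis I \<alpha> d"
    and "\<forall>s\<in>I. vec_angle (principal_normal I \<alpha> s) d = \<theta>"
  shows "\<exists>\<epsilon>\<in>{1, -1::real}. \<forall>s\<in>I.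
    d = (\<epsilon> * (torsion I \<alpha> s / sqrt ((curvature I \<alpha> s)\<^sup>2 + (torsion I \<alpha> s)\<^sup>2)) * sin \<theta>) *\<^sub>R tangent I \<alpha> s
      + cos \<theta> *\<^sub>R principal_normal I \<alpha> s
      + (\<epsilon> * (curvature I \<alpha> s / sqrt ((curvature I \<alpha> s)\<^sup>2 + (torsion I \<alpha> s)\<^sup>2)) * sin \<theta>) *\<^sub>R binormal I \<alpha> s"
proof -
  have normal_nonzero: "principal_normal I \<alpha> s \<noteq> 0" if "s \<in> I" for s
    using norm_principal_normal [OF assms(1-4) that] by force
  \<comment> \<open>A point of \<open>I\<close> is needed to know that \<theta> is a value of
    \<open>vec_angle\<close>, hence has a nonnegative sine.\<close>
  obtain s0 where "s0 \<in> I"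
    using assms(1) interior_subset by (fastforce simp: nondegenerate_interval_def)
  have "d \<noteq> 0"
    using assms(5) by auto
  have axis: "inner (principal_normal I \<alpha> s) d = cos \<theta>" if "s \<in> I" for s
    using cos_vec_angle [OF normal_nonzero [OF that] \<open>d \<noteq> 0\<close>] norm_principal_normal [OF assms(1-4) that]
      assms(5,7) that by simp
  have sin_nonneg: "0 \<le> sin \<theta>"
    using sin_vec_angle_nonneg [OF normal_nonzero [OF \<open>s0 \<in> I\<close>] \<open>d \<noteq> 0\<close>] assms(7) \<open>s0 \<in> I\<close> by simp
  define a where "a s = inner (tangent I \<alpha> s) d" for s
  define b where "b s = inner (binormal I \<alpha> s) d" for s
  define \<omega> where "\<omega> s = sqrt ((curvature I \<alpha> s)\<^sup>2 + (torsion I \<alpha> s)\<^sup>2)" for s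
  have pos: "curvature I \<alpha> s > 0" "\<omega> s > 0" if "s \<in> I" for s
    using assms(4) that by (auto simp: \<omega>_def add_pos_nonneg)
  have a: "a s = torsion I \<alpha> s * b s / curvature I \<alpha> s" if "s \<in> I" for s
    using curvature_inner_tangent_axis [OF assms(1-4) axis that] pos(1) [OF that]
    by (simp add: a_def b_def field_simps)
  have abs_b: "\<bar>b s\<bar> = curvature I \<alpha> s / \<omega> s * sin \<theta>" if s: "s \<in> I" for s
  proof -
    have "1 = (a s)\<^sup>2 + (cos \<theta>)\<^sup>2 + (b s)\<^sup>2"
      using inner_frame_expansion [OF assms(1-4) s, of d d] assms(5) axis [OF s]
      by (simp add: a_def b_def power2_eq_square dot_square_norm)
    then have "(a s)\<^sup>2 + (b s)\<^sup>2 = (sin \<theta>)\<^sup>2"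
      by (simp add: sin_squared_eq)
    \<comment> \<open>Substituting \<open>a s\<close> by its multiple of \<open>b s\<close> and
      clearing the squared curvature makes the squared \<omega> appear.\<close>
    then have "(b s)\<^sup>2 * (\<omega> s)\<^sup>2 = (curvature I \<alpha> s)\<^sup>2 * (sin \<theta>)\<^sup>2"
      using pos(1) [OF s] by (simp add: a [OF s] \<omega>_def field_simps)
    then have "(\<bar>b s\<bar> * \<omega> s)\<^sup>2 = (curvature I \<alpha> s * sin \<theta>)\<^sup>2"
      by (simp add: power_mult_distrib)
    \<comment> \<open>Both sides are nonnegative, so equal squares suffice.\<close>
    then have "\<bar>b s\<bar> * \<omega> s = curvature I \<alpha> s * sin \<theta>"
      using pos [OF s] sin_nonneg by (simp add: power2_eq_iff_nonneg)
    then show ?thesis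
      using pos(2) [OF s] by (simp add: field_simps)
  qed
  obtain \<epsilon> where \<epsilon>: "\<epsilon> \<in> {1, -1::real}" "\<And>s. s \<in> I \<Longrightarrow> b s = \<epsilon> * \<bar>b s\<bar>"
  proof (cases "sin \<theta> = 0")
    \<comment> \<open>Here \<open>b\<close> vanishes on \<open>I\<close>, so either sign would
      do.\<close>
    case True
    then show thesis
      using abs_b that [of 1] by simp
  next
    case False
    have "connected I"
      using assms(1) by (simp add: nondegenerate_interval_def is_interval_connected)
    moreover have "continuous_on I b"
      unfolding b_def by (intro continuous_intros continuous_on_binormal assms(1-4))
    moreover have "b s \<noteq> 0" if "s \<in> I" for s
      using abs_b [OF that] pos [OF that] False by auto
    ultimately show thesis
      using connected_nonvanishing_sign that by blast
  qed
  have "d = (\<epsilon> * (torsion I \<alpha> s / \<omega> s) * sin \<theta>) *\<^sub>R tangent I \<alpha> s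
      + cos \<theta> *\<^sub>R principal_normal I \<alpha> s
      + (\<epsilon> * (curvature I \<alpha> s / \<omega> s) * sin \<theta>) *\<^sub>R binormal I \<alpha> s" if s: "s \<in> I" for s
  proof -
    have b_eq: "b s = \<epsilon> * (curvature I \<alpha> s / \<omega> s) * sin \<theta>"
      using \<epsilon>(2) [OF s] abs_b [OF s] by simp
    \<comment> \<open>The factor \<open>torsion I \<alpha> s / curvature I \<alpha> s\<close>
      relating \<open>a s\<close> to \<open>b s\<close> is signed, so the same \<epsilon> serves for
      both coordinates.\<close>
    then have "a s = \<epsilon> * (torsion I \<alpha> s / \<omega> s) * sin \<theta>"
      using a [OF s] pos [OF s] by simp
    with b_eq show ?thesis
      using frame_expansion [OF assms(1-4) s, of d] axis [OF s] by (simp add: a_def b_def)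
  qed
  with \<epsilon>(1) show ?thesis
    unfolding \<omega>_def by blast
qed

end
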